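(* Let $X$ be a Banach space and let $q\geq2$. The following are equivalent: (i) $\mathcal F(X)$ has Rademacher cotype (resp. cotype $q$); (ii) $\mathcal F(K)$ has Rademacher cotype (resp. cotype $q$) for every compact set $K\subset X$; (ii') $\mathcal F(K)$ has Rademacher cotype (resp. cotype $q$) for every countable compact set $K\subset X$; (iii) $\mathcal F(\{x_n\}_n)$ has Rademacher cotype (resp. cotype $q$) for every null sequence $(x_n)_n\subset X$.
   Context: For a pointed metric space $M$ (the choice of base point does not affect the isomorphism class), $\mathrm{Lip}_0(M)$ is the Banach space of real Lipschitz functions vanishing at the base point normed by the Lipschitz constant, and $\mathcal F(M)=\overline{\mathrm{span}}\{\delta(x):x\in M\}\subset\mathrm{Lip}_0(M)^*$, $\delta(x)$ being evaluation at $x$. A Banach space has Rademacher cotype if it has cotype $q$ for some $q<\infty$. A null sequence is a sequence converging to $0$ in norm; $\{x_n\}_n$ denotes its set of terms with the metric from $X$. *)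

theory Defs
  imports "HOL-Analysis.Analysis"
begin

text \<open>Lipschitz-free space over a subset M of a metric space, realised inside
the dual of Lip_0(M).  A functional is any map from real functions to reals;
Lip_0(M) is represented by functions vanishing off M (values off M are irrelevant),
vanishing at a base point of M, and its closed unit ball is the set of such
functions which are 1-Lipschitz on M.\<close>

definition base_point :: "'a set \<Rightarrow> 'a" where
  "base_point M = (SOME p. p \<in> M)"

definition lip0_ball :: "'a::metric_space set \<Rightarrow> ('a \<Rightarrow> real) set" where
  "lip0_ball M = {f. 1-lipschitz_on M f \<and> (\<forall>x. x \<notin> M \<longrightarrow> f x = 0)
                      \<and> (M \<noteq> {} \<longrightarrow> f (base_point M) = 0)}"

text \<open>Dual norm on Lip_0(M)^*.\<close>
definition free_norm :: "'a::metric_space set \<Rightarrow> (('a \<Rightarrow> real) \<Rightarrow> real) \<Rightarrow> real" where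
  "free_norm M \<phi> = Sup {\<bar>\<phi> f\<bar> | f. f \<in> lip0_ball M}"

text \<open>F(M): the norm closure in Lip_0(M)^* of the span of the evaluations delta(x), x in M.\<close>
definition free_space :: "'a::metric_space set \<Rightarrow> (('a \<Rightarrow> real) \<Rightarrow> real) set" where
  "free_space M = {\<phi>. \<forall>e>0. \<exists>S a. finite S \<and> S \<subseteq> M \<and>
       (\<forall>f \<in> lip0_ball M. \<bar>\<phi> f - (\<Sum>x\<in>S. a x * f x)\<bar> \<le> e)}"

text \<open>Sign vectors of length n.\<close>
definition signs :: "nat \<Rightarrow> (nat \<Rightarrow> real) set" where
  "signs n = {\<epsilon>. (\<forall>i<n. \<epsilon> i \<in> {-1, 1}) \<and> (\<forall>i\<ge>n. \<epsilon> i = 0)}"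

text \<open>Rademacher cotype q of F(M): there is C such that for all finitely many
x_1..x_n in F(M), (sum ||x_i||^q)^(1/q) <= C (Average_eps ||sum eps_i x_i||^2)^(1/2).\<close>
definition free_has_cotype :: "'a::metric_space set \<Rightarrow> real \<Rightarrow> bool" where
  "free_has_cotype M q \<longleftrightarrow> (\<exists>C>0. \<forall>n v. (\<forall>i<n. v i \<in> free_space M) \<longrightarrow>
      (\<Sum>i<n. free_norm M (v i) powr q) powr (1/q)
        \<le> C * sqrt ((\<Sum>\<epsilon>\<in>signs n. (free_norm M (\<lambda>f. \<Sum>i<n. \<epsilon> i * v i f))\<^sup>2) / 2 ^ n))"

definition free_has_rademacher_cotype :: "'a::metric_space set \<Rightarrow> bool" where
  "free_has_rademacher_cotype M \<longleftrightarrow> (\<exists>q. 2 \<le> q \<and> free_has_cotype M q)"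

end

theory Submission
  imports Defs
begin

(* A molecule, i.e. a finitely supported measure of total mass zero, has the same norm in F(M)
   as in F(S) for its support S (McShane extension), and molecules are dense in F(M).  Hence
   F(M) has cotype q with constant C iff the cotype inequality with constant C holds for all
   families of molecules supported in finite subsets of M.  This condition passes to subsets,
   which gives (i) => (ii), (ii'), (iii).  Conversely, if F(X) fails cotype q, then for every k
   some finite set S_k violates the inequality with constant k.  Dilating a finite set together
   with its molecules does not change their norms, so S_k may be taken inside the ball of
   radius 1/(k+1); then 0 and all the S_k form the range of a null sequence, a countable compact
   set on which the inequality fails for every constant.  For Rademacher cotype the exponent is
   made to grow with k as well. *)

section \<open>Molecules and the norm of the free space\<close>

definition delta_sum :: "'a set \<Rightarrow> ('a \<Rightarrow> real) \<Rightarrow> ('a \<Rightarrow> real) \<Rightarrow> real" where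
  "delta_sum S a = (\<lambda>f. \<Sum>x\<in>S. a x * f x)"

definition lip_dual_norm :: "'a::metric_space set \<Rightarrow> ('a \<Rightarrow> real) \<Rightarrow> real" where
  "lip_dual_norm S a = Sup {\<bar>\<Sum>x\<in>S. a x * g x\<bar> | g. 1-lipschitz_on S g}"

definition dual_bounded :: "'a::metric_space set \<Rightarrow> (('a \<Rightarrow> real) \<Rightarrow> real) \<Rightarrow> bool" where
  "dual_bounded M \<phi> \<longleftrightarrow> bdd_above {\<bar>\<phi> f\<bar> | f. f \<in> lip0_ball M}"

lemma zero_in_lip0_ball: "(\<lambda>_. 0) \<in> lip0_ball M"
  by (simp add: lip0_ball_def lipschitz_on_def)

lemma base_point_in: "M \<noteq> {} \<Longrightarrow> base_point M \<in> M"
  unfolding base_point_def by (simp add: some_in_eq)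

lemma lip0_ball_base_point: "f \<in> lip0_ball M \<Longrightarrow> x \<in> M \<Longrightarrow> f (base_point M) = 0"
  unfolding lip0_ball_def by blast

lemma abs_lip0_ball_le_dist:
  assumes "f \<in> lip0_ball M" "x \<in> M"
  shows "\<bar>f x\<bar> \<le> dist x (base_point M)"
proof -
  have "base_point M \<in> M" using assms(2) base_point_in by blast
  then have "dist (f x) (f (base_point M)) \<le> 1 * dist x (base_point M)"
    using assms unfolding lip0_ball_def lipschitz_on_def by blast
  then show ?thesis using lip0_ball_base_point[OF assms] by (simp add: dist_real_def)
qed

lemma free_norm_upper: "dual_bounded M \<phi> \<Longrightarrow> f \<in> lip0_ball M \<Longrightarrow> \<bar>\<phi> f\<bar> \<le> free_norm M \<phi>"
  unfolding dual_bounded_def free_norm_def by (rule cSup_upper) auto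

lemma free_norm_nonneg: "dual_bounded M \<phi> \<Longrightarrow> 0 \<le> free_norm M \<phi>"
  using free_norm_upper[OF _ zero_in_lip0_ball, of M \<phi>] by simp

lemma dual_bounded_delta_sum:
  assumes "finite S" "S \<subseteq> M"
  shows "dual_bounded M (delta_sum S a)"
proof -
  have "\<bar>delta_sum S a f\<bar> \<le> (\<Sum>x\<in>S. \<bar>a x\<bar> * dist x (base_point M))" if "f \<in> lip0_ball M" for f
  proof -
    have "\<bar>delta_sum S a f\<bar> \<le> (\<Sum>x\<in>S. \<bar>a x * f x\<bar>)"
      unfolding delta_sum_def by (rule sum_abs)
    also have "\<dots> \<le> (\<Sum>x\<in>S. \<bar>a x\<bar> * dist x (base_point M))"
    proof (rule sum_mono)
      fix x assume "x \<in> S"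
      then have "\<bar>f x\<bar> \<le> dist x (base_point M)" using abs_lip0_ball_le_dist[OF that] assms(2) by blast
      then show "\<bar>a x * f x\<bar> \<le> \<bar>a x\<bar> * dist x (base_point M)"
        unfolding abs_mult by (rule mult_left_mono) simp
    qed
    finally show ?thesis .
  qed
  then show ?thesis unfolding dual_bounded_def bdd_above_def by blast
qed

lemma dual_bounded_approx:
  assumes "dual_bounded M \<psi>" "\<forall>f\<in>lip0_ball M. \<bar>\<phi> f - \<psi> f\<bar> \<le> e"
  shows "dual_bounded M \<phi>"
proof -
  have "\<bar>\<phi> f\<bar> \<le> free_norm M \<psi> + e" if "f \<in> lip0_ball M" for f
  proof -
    have "\<bar>\<psi> f\<bar> \<le> free_norm M \<psi>" "\<bar>\<phi> f - \<psi> f\<bar> \<le> e"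
      using free_norm_upper[OF assms(1) that] assms(2) that by auto
    then show ?thesis by linarith
  qed
  then show ?thesis unfolding dual_bounded_def bdd_above_def by blast
qed

lemma free_norm_approx_le:
  assumes "dual_bounded M \<psi>" "\<forall>f\<in>lip0_ball M. \<bar>\<phi> f - \<psi> f\<bar> \<le> e"
  shows "free_norm M \<phi> \<le> free_norm M \<psi> + e"
  unfolding free_norm_def[of M \<phi>]
proof (rule cSup_least)
  show "{\<bar>\<phi> f\<bar> |f. f \<in> lip0_ball M} \<noteq> {}" using zero_in_lip0_ball by blast
next
  fix t assume "t \<in> {\<bar>\<phi> f\<bar> |f. f \<in> lip0_ball M}"
  then obtain f where f: "f \<in> lip0_ball M" "t = \<bar>\<phi> f\<bar>" by blast
  have "\<bar>\<psi> f\<bar> \<le> free_norm M \<psi>" "\<bar>\<phi> f - \<psi> f\<bar> \<le> e"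
    using free_norm_upper[OF assms(1) f(1)] assms(2) f(1) by auto
  then show "t \<le> free_norm M \<psi> + e" using f(2) by linarith
qed

lemma abs_free_norm_diff_le:
  assumes "dual_bounded M \<psi>" "\<forall>f\<in>lip0_ball M. \<bar>\<phi> f - \<psi> f\<bar> \<le> e"
  shows "\<bar>free_norm M \<phi> - free_norm M \<psi>\<bar> \<le> e"
proof -
  have "free_norm M \<psi> \<le> free_norm M \<phi> + e"
    using free_norm_approx_le[OF dual_bounded_approx[OF assms]] assms(2)
    by (simp add: abs_minus_commute)
  then show ?thesis using free_norm_approx_le[OF assms] by linarith
qed

lemma delta_sum_in_free_space:
  assumes "finite S" "S \<subseteq> M"
  shows "delta_sum S a \<in> free_space M"
  unfolding free_space_def delta_sum_def using assms
  by (intro CollectI allI impI exI[of _ S] exI[of _ a]) simp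

lemma dual_bounded_free_space: "\<phi> \<in> free_space M \<Longrightarrow> dual_bounded M \<phi>"
proof -
  assume "\<phi> \<in> free_space M"
  then have "\<exists>S a. finite S \<and> S \<subseteq> M \<and> (\<forall>f\<in>lip0_ball M. \<bar>\<phi> f - delta_sum S a f\<bar> \<le> 1)"
    unfolding free_space_def delta_sum_def by simp
  then obtain S a where "finite S" "S \<subseteq> M" and approx: "\<forall>f\<in>lip0_ball M. \<bar>\<phi> f - delta_sum S a f\<bar> \<le> 1"
    by blast
  then show ?thesis using dual_bounded_approx[OF dual_bounded_delta_sum] approx by blast
qed

lemma delta_sum_lincomb:
  "(\<lambda>f. \<Sum>i\<in>I. c i * delta_sum S (a i) f) = delta_sum S (\<lambda>x. \<Sum>i\<in>I. c i * a i x)"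
proof
  fix f
  have "(\<Sum>i\<in>I. c i * delta_sum S (a i) f) = (\<Sum>i\<in>I. \<Sum>x\<in>S. c i * a i x * f x)"
    unfolding delta_sum_def by (simp add: sum_distrib_left mult.assoc)
  also have "\<dots> = delta_sum S (\<lambda>x. \<Sum>i\<in>I. c i * a i x) f"
    unfolding delta_sum_def by (subst sum.swap) (simp add: sum_distrib_right)
  finally show "(\<Sum>i\<in>I. c i * delta_sum S (a i) f) = delta_sum S (\<lambda>x. \<Sum>i\<in>I. c i * a i x) f" .
qed

lemma sum_lincomb_eq_0:
  "\<forall>i\<in>I. sum (a i) S = 0 \<Longrightarrow> (\<Sum>x\<in>S. \<Sum>i\<in>I. c i * a i x) = (0::real)"
  by (subst sum.swap) (simp add: sum_distrib_left[symmetric])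

lemma delta_sum_zero_extend:
  assumes "finite T" "S \<subseteq> T"
  shows "delta_sum T (\<lambda>x. if x \<in> S then a x else 0) = delta_sum S a"
    and "(\<Sum>x\<in>T. if x \<in> S then a x else 0) = sum a S"
proof -
  have "(\<Sum>x\<in>T. (if x \<in> S then a x else 0) * f x) = (\<Sum>x\<in>T. if x \<in> S then a x * f x else 0)" for f
    by (intro sum.cong) auto
  then show "delta_sum T (\<lambda>x. if x \<in> S then a x else 0) = delta_sum S a"
    unfolding delta_sum_def using assms by (simp add: sum.inter_restrict[symmetric] Int_absorb1)
  show "(\<Sum>x\<in>T. if x \<in> S then a x else 0) = sum a S"
    using assms by (simp add: sum.inter_restrict[symmetric] Int_absorb1)
qed

lemma lipschitz_extension_finite:
  fixes g :: "'a::metric_space \<Rightarrow> real"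
  assumes "finite S" "L-lipschitz_on S g"
  shows "\<exists>h. L-lipschitz_on UNIV h \<and> (\<forall>x\<in>S. h x = g x)"
proof (cases "S = {}")
  case True
  then show ?thesis using assms(2) by (intro exI[of _ "\<lambda>_. 0"]) (simp add: lipschitz_on_def)
next
  case False
  have L: "0 \<le> L" and g: "\<And>x y. x \<in> S \<Longrightarrow> y \<in> S \<Longrightarrow> \<bar>g x - g y\<bar> \<le> L * dist x y"
    using assms(2) by (auto simp: lipschitz_on_def dist_real_def)
  define h where "h y = Min ((\<lambda>s. g s + L * dist y s) ` S)" for y
  have h_le: "h y \<le> g s + L * dist y s" if "s \<in> S" for y s
    unfolding h_def using assms(1) that by simp
  have h_attained: "\<exists>s\<in>S. h y = g s + L * dist y s" for y
  proof -
    have "h y \<in> (\<lambda>s. g s + L * dist y s) ` S"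
      unfolding h_def using assms(1) False by (intro Min_in) auto
    then show ?thesis by blast
  qed
  have "h y \<le> h z + L * dist y z" for y z
  proof -
    obtain s where s: "s \<in> S" "h z = g s + L * dist z s" using h_attained by blast
    have "h y \<le> g s + L * dist y s" using h_le s(1) .
    also have "\<dots> \<le> g s + L * dist z s + L * dist y z"
      using dist_triangle[of y s z] L by (simp add: dist_commute mult_left_mono flip: distrib_left)
    finally show ?thesis using s(2) by simp
  qed
  then have "L-lipschitz_on UNIV h"
    using L unfolding lipschitz_on_def dist_real_def
    by (smt (verit, best) dist_commute)
  moreover have "h x = g x" if "x \<in> S" for x
  proof -
    obtain s where "s \<in> S" "h x = g s + L * dist x s" using h_attained by blast
    then show ?thesis using h_le[OF that, of x] g[OF that, of s] by simp
  qed
  ultimately show ?thesis by blast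
qed

text \<open>Since the coefficients of a molecule sum to zero, its action is unchanged by adding a
  constant to the test function; this absorbs the normalisation at the base point, and
  McShane extension removes the dependence on the ambient set.\<close>

lemma free_norm_molecule:
  assumes "finite S" "S \<subseteq> M" "sum a S = 0"
  shows "free_norm M (delta_sum S a) = lip_dual_norm S a"
proof -
  have "{\<bar>delta_sum S a f\<bar> | f. f \<in> lip0_ball M} = {\<bar>\<Sum>x\<in>S. a x * g x\<bar> | g. 1-lipschitz_on S g}"
  proof (intro equalityI subsetI)
    fix t assume "t \<in> {\<bar>delta_sum S a f\<bar> | f. f \<in> lip0_ball M}"
    then obtain f where f: "f \<in> lip0_ball M" "t = \<bar>delta_sum S a f\<bar>" by blast
    have "1-lipschitz_on S f"
      using f(1) assms(2) lipschitz_on_subset unfolding lip0_ball_def by blast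
    then show "t \<in> {\<bar>\<Sum>x\<in>S. a x * g x\<bar> | g. 1-lipschitz_on S g}"
      using f(2) unfolding delta_sum_def by blast
  next
    fix t assume "t \<in> {\<bar>\<Sum>x\<in>S. a x * g x\<bar> | g. 1-lipschitz_on S g}"
    then obtain g where g: "1-lipschitz_on S g" "t = \<bar>\<Sum>x\<in>S. a x * g x\<bar>" by blast
    show "t \<in> {\<bar>delta_sum S a f\<bar> | f. f \<in> lip0_ball M}"
    proof (cases "M = {}")
      case True
      then show ?thesis using g(2) assms(2) zero_in_lip0_ball[of M] unfolding delta_sum_def by force
    next
      case False
      obtain h where h: "1-lipschitz_on UNIV h" "\<forall>x\<in>S. h x = g x"
        using lipschitz_extension_finite[OF assms(1) g(1)] by blast
      define p where "p = base_point M"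
      define f where "f y = (if y \<in> M then h y - h p else 0)" for y
      have "1-lipschitz_on M f"
        using h(1) unfolding lipschitz_on_def f_def by (simp add: dist_real_def)
      then have f: "f \<in> lip0_ball M"
        unfolding lip0_ball_def f_def p_def using base_point_in[OF False] by simp
      have "delta_sum S a f = (\<Sum>x\<in>S. a x * g x - a x * h p)"
        unfolding delta_sum_def f_def using assms(2) h(2)
        by (intro sum.cong) (auto simp: algebra_simps)
      also have "\<dots> = (\<Sum>x\<in>S. a x * g x) - (\<Sum>x\<in>S. a x) * h p"
        by (simp add: sum_subtractf sum_distrib_right)
      finally have "t = \<bar>delta_sum S a f\<bar>" using g(2) assms(3) by simp
      then show ?thesis using f by blast
    qed
  qed
  then show ?thesis unfolding free_norm_def lip_dual_norm_def by simp
qed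

text \<open>Adding the base point to the support, with the opposite of the total mass as its
  coefficient, does not change the action on functions vanishing at the base point.\<close>

lemma free_space_approx_molecule:
  assumes "\<phi> \<in> free_space M" "e > 0"
  shows "\<exists>S a. finite S \<and> S \<subseteq> M \<and> sum a S = 0 \<and> (\<forall>f\<in>lip0_ball M. \<bar>\<phi> f - delta_sum S a f\<bar> \<le> e)"
proof -
  have "\<exists>S0 a0. finite S0 \<and> S0 \<subseteq> M \<and> (\<forall>f\<in>lip0_ball M. \<bar>\<phi> f - delta_sum S0 a0 f\<bar> \<le> e)"
    using assms unfolding free_space_def delta_sum_def mem_Collect_eq by blast
  then obtain S0 a0 where S0: "finite S0" "S0 \<subseteq> M" and
    approx: "\<forall>f\<in>lip0_ball M. \<bar>\<phi> f - delta_sum S0 a0 f\<bar> \<le> e"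
    by blast
  show ?thesis
  proof (cases "S0 = {}")
    case True
    then show ?thesis using S0 approx by (intro exI[of _ S0] exI[of _ a0]) simp
  next
    case False
    define p where "p = base_point M"
    have p: "p \<in> M" unfolding p_def using False S0(2) base_point_in by blast
    define S where "S = insert p S0"
    define a where "a x = (if x \<in> S0 then a0 x else 0) - (if x = p then sum a0 S0 else 0)" for x
    have S: "finite S" "S0 \<subseteq> S" "p \<in> S" unfolding S_def using S0(1) by auto
    have "sum a S = 0"
      unfolding a_def sum_subtractf delta_sum_zero_extend(2)[OF S(1,2)] using S(1,3) by simp
    moreover have "delta_sum S a f = delta_sum S0 a0 f" if "f \<in> lip0_ball M" for f
    proof -
      have "(\<Sum>x\<in>S. (if x = p then sum a0 S0 else 0) * f x) = (\<Sum>x\<in>S. if x = p then sum a0 S0 * f x else 0)"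
        by (intro sum.cong) auto
      also have "\<dots> = sum a0 S0 * f p" using S(1,3) by simp
      finally have "delta_sum S a f = delta_sum S (\<lambda>x. if x \<in> S0 then a0 x else 0) f - sum a0 S0 * f p"
        unfolding delta_sum_def a_def left_diff_distrib sum_subtractf by simp
      then have "delta_sum S a f = delta_sum S0 a0 f - sum a0 S0 * f p"
        unfolding delta_sum_zero_extend(1)[OF S(1,2)] .
      then show ?thesis using lip0_ball_base_point[OF that p] p_def by simp
    qed
    moreover have "S \<subseteq> M" unfolding S_def using S0(2) p by simp
    ultimately show ?thesis using S(1) approx by (intro exI[of _ S] exI[of _ a]) simp
  qed
qed

lemma free_space_approx_molecules:
  fixes n :: nat
  assumes "\<forall>i<n. v i \<in> free_space M" "e > 0"
  shows "\<exists>S a. finite S \<and> S \<subseteq> M \<and> (\<forall>i<n. sum (a i) S = 0)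
           \<and> (\<forall>i<n. \<forall>f\<in>lip0_ball M. \<bar>v i f - delta_sum S (a i) f\<bar> \<le> e)"
proof -
  define P where "P i S a \<longleftrightarrow> finite S \<and> S \<subseteq> M \<and> sum a S = 0
      \<and> (\<forall>f\<in>lip0_ball M. \<bar>v i f - delta_sum S a f\<bar> \<le> e)" for i S a
  have "\<forall>i. \<exists>S a. i < n \<longrightarrow> P i S a"
  proof
    fix i show "\<exists>S a. i < n \<longrightarrow> P i S a"
      using free_space_approx_molecule[OF assms(1)[rule_format] assms(2)] unfolding P_def
      by (cases "i < n") simp_all
  qed
  then have "\<exists>Si. \<forall>i. \<exists>a. i < n \<longrightarrow> P i (Si i) a" by (rule choice)
  then obtain Si where "\<forall>i. \<exists>a. i < n \<longrightarrow> P i (Si i) a" by blast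
  then have "\<exists>ai. \<forall>i. i < n \<longrightarrow> P i (Si i) (ai i)" by (rule choice)
  then obtain ai where "\<forall>i. i < n \<longrightarrow> P i (Si i) (ai i)" by blast
  then have Si: "finite (Si i)" "Si i \<subseteq> M" "sum (ai i) (Si i) = 0"
    "\<forall>f\<in>lip0_ball M. \<bar>v i f - delta_sum (Si i) (ai i) f\<bar> \<le> e" if "i < n" for i
    using that unfolding P_def by auto
  define S where "S = (\<Union>i<n. Si i)"
  define a where "a i = (\<lambda>x. if x \<in> Si i then ai i x else 0)" for i
  have S: "finite S" "S \<subseteq> M" unfolding S_def using Si(1,2) by auto
  have sub: "Si i \<subseteq> S" if "i < n" for i unfolding S_def using that by auto
  show ?thesis
    using S Si delta_sum_zero_extend[OF S(1) sub]
    by (intro exI[of _ S] exI[of _ a]) (simp add: a_def)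
qed

lemma free_space_molecule_sequence:
  fixes n :: nat
  assumes "\<forall>i<n. v i \<in> free_space M"
  shows "\<exists>S a. \<forall>k. finite (S k) \<and> S k \<subseteq> M \<and> (\<forall>i<n. sum (a k i) (S k) = 0)
           \<and> (\<forall>i<n. \<forall>f\<in>lip0_ball M. \<bar>v i f - delta_sum (S k) (a k i) f\<bar> \<le> 1 / real (Suc k))"
proof -
  define P where "P k S a \<longleftrightarrow> finite S \<and> S \<subseteq> M \<and> (\<forall>i<n. sum (a i) S = 0)
      \<and> (\<forall>i<n. \<forall>f\<in>lip0_ball M. \<bar>v i f - delta_sum S (a i) f\<bar> \<le> 1 / real (Suc k))"
    for k S and a :: "nat \<Rightarrow> 'a \<Rightarrow> real"
  have "\<forall>k. \<exists>S a. P k S a"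
    unfolding P_def using free_space_approx_molecules[OF assms] by simp
  then have "\<exists>S. \<forall>k. \<exists>a. P k (S k) a" by (rule choice)
  then obtain S where "\<forall>k. \<exists>a. P k (S k) a" by blast
  then have "\<exists>a. \<forall>k. P k (S k) (a k)" by (rule choice)
  then show ?thesis unfolding P_def by blast
qed

lemma free_norm_tendsto_uniform:
  assumes "\<forall>k. dual_bounded M (\<psi> k)"
    and "\<forall>k. \<forall>f\<in>lip0_ball M. \<bar>\<phi> f - \<psi> k f\<bar> \<le> D / real (Suc k)"
  shows "(\<lambda>k. free_norm M (\<psi> k)) \<longlonglongrightarrow> free_norm M \<phi>"
proof -
  have lim0: "(\<lambda>k. D / real (Suc k)) \<longlonglongrightarrow> 0"
    using LIMSEQ_Suc[OF lim_const_over_n[of D]] by simp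
  have bound: "norm (free_norm M (\<psi> k) - free_norm M \<phi>) \<le> D / real (Suc k)" for k
  proof -
    have "\<bar>free_norm M \<phi> - free_norm M (\<psi> k)\<bar> \<le> D / real (Suc k)"
      by (rule abs_free_norm_diff_le[OF spec[OF assms(1)] spec[OF assms(2)]])
    then show ?thesis by (simp only: real_norm_def abs_minus_commute)
  qed
  have "(\<lambda>k. free_norm M (\<psi> k) - free_norm M \<phi>) \<longlonglongrightarrow> 0"
    using always_eventually[OF allI[OF bound]] lim0 by (rule Lim_null_comparison)
  then show ?thesis by (rule LIM_zero_cancel)
qed

section \<open>Cotype inequalities for molecules\<close>

definition lq_sum :: "(('c \<Rightarrow> real) \<Rightarrow> real) \<Rightarrow> real \<Rightarrow> nat \<Rightarrow> (nat \<Rightarrow> 'c \<Rightarrow> real) \<Rightarrow> real" where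
  "lq_sum N q n v = (\<Sum>i<n. N (v i) powr q) powr (1/q)"

definition rademacher_mean :: "(('c \<Rightarrow> real) \<Rightarrow> real) \<Rightarrow> nat \<Rightarrow> (nat \<Rightarrow> 'c \<Rightarrow> real) \<Rightarrow> real" where
  "rademacher_mean N n v = sqrt ((\<Sum>\<epsilon>\<in>signs n. (N (\<lambda>z. \<Sum>i<n. \<epsilon> i * v i z))\<^sup>2) / 2 ^ n)"

definition free_cotype_with :: "'a::metric_space set \<Rightarrow> real \<Rightarrow> real \<Rightarrow> bool" where
  "free_cotype_with M q C \<longleftrightarrow> (\<forall>n v. (\<forall>i<n. v i \<in> free_space M) \<longrightarrow>
      lq_sum (free_norm M) q n v \<le> C * rademacher_mean (free_norm M) n v)"

definition molecule_cotype_with :: "'a::metric_space set \<Rightarrow> real \<Rightarrow> real \<Rightarrow> bool" where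
  "molecule_cotype_with M q C \<longleftrightarrow> (\<forall>n S a. finite S \<and> S \<subseteq> M \<and> (\<forall>i<n. sum (a i) S = 0) \<longrightarrow>
      lq_sum (lip_dual_norm S) q n a \<le> C * rademacher_mean (lip_dual_norm S) n a)"

lemma free_has_cotype_iff: "free_has_cotype M q \<longleftrightarrow> (\<exists>C>0. free_cotype_with M q C)"
  unfolding free_has_cotype_def free_cotype_with_def lq_sum_def rademacher_mean_def ..

lemma rademacher_mean_nonneg: "0 \<le> rademacher_mean N n v"
  unfolding rademacher_mean_def by (simp add: sum_nonneg)

lemma sum_powr_root_antimono:
  fixes w :: "'i \<Rightarrow> real"
  assumes "finite I" "\<forall>i\<in>I. 0 \<le> w i" "0 < q" "q \<le> r"
  shows "(\<Sum>i\<in>I. w i powr r) powr (1/r) \<le> (\<Sum>i\<in>I. w i powr q) powr (1/q)"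
proof -
  define s where "s = (\<Sum>i\<in>I. w i powr q) powr (1/q)"
  show ?thesis
  proof (cases "s = 0")
    case True
    then have "\<forall>i\<in>I. w i powr q = 0"
      unfolding s_def using assms(1) by (simp add: sum_nonneg_eq_0_iff)
    then show ?thesis by simp
  next
    case False
    then have s: "0 < s" unfolding s_def by simp
    have sq: "s powr q = (\<Sum>i\<in>I. w i powr q)"
      unfolding s_def powr_powr using assms(3) by (simp add: sum_nonneg)
    have w_le_s: "w i \<le> s" if "i \<in> I" for i
    proof -
      have "w i powr q \<le> s powr q" unfolding sq using assms(1) that by (intro member_le_sum) auto
      moreover have "s powr q < w i powr q" if "s < w i"
        using that s assms(3) by (intro powr_less_mono2) auto
      ultimately show ?thesis by linarith
    qed
    have "(\<Sum>i\<in>I. w i powr r) / s powr r = (\<Sum>i\<in>I. (w i / s) powr r)"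
      using assms(2) s by (simp add: powr_divide sum_divide_distrib)
    also have "\<dots> \<le> (\<Sum>i\<in>I. (w i / s) powr q)"
      using assms(2,4) w_le_s s by (intro sum_mono powr_mono') auto
    also have "\<dots> = 1"
      using assms(2) s sq powr_gt_zero[of s q] by (simp add: powr_divide sum_divide_distrib[symmetric])
    finally have "(\<Sum>i\<in>I. w i powr r) \<le> s powr r" using s by (simp add: divide_le_eq)
    then have "(\<Sum>i\<in>I. w i powr r) powr (1/r) \<le> (s powr r) powr (1/r)"
      using assms(3,4) by (intro powr_mono2) (auto simp: sum_nonneg)
    then show ?thesis unfolding powr_powr using assms(3,4) s by (simp add: s_def)
  qed
qed

lemma free_cotype_with_mono:
  assumes "free_cotype_with M q C" "0 < q" "q \<le> r" "C \<le> D"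
  shows "free_cotype_with M r D"
  unfolding free_cotype_with_def
proof (intro allI impI)
  fix n :: nat and v :: "nat \<Rightarrow> ('a \<Rightarrow> real) \<Rightarrow> real"
  assume v: "\<forall>i<n. v i \<in> free_space M"
  have "lq_sum (free_norm M) r n v \<le> lq_sum (free_norm M) q n v"
    unfolding lq_sum_def using v assms(2,3)
    by (intro sum_powr_root_antimono) (auto intro: free_norm_nonneg dual_bounded_free_space)
  also have "\<dots> \<le> C * rademacher_mean (free_norm M) n v"
    using assms(1) v unfolding free_cotype_with_def by blast
  also have "\<dots> \<le> D * rademacher_mean (free_norm M) n v"
    using assms(4) rademacher_mean_nonneg by (rule mult_right_mono)
  finally show "lq_sum (free_norm M) r n v \<le> D * rademacher_mean (free_norm M) n v" .
qed

lemma lq_sum_free_norm_molecule: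
  assumes "finite S" "S \<subseteq> M" "\<forall>i<n. sum (a i) S = 0"
  shows "lq_sum (free_norm M) q n (\<lambda>i. delta_sum S (a i)) = lq_sum (lip_dual_norm S) q n a"
  unfolding lq_sum_def using assms by (simp add: free_norm_molecule)

lemma rademacher_mean_free_norm_molecule:
  assumes "finite S" "S \<subseteq> M" "\<forall>i<n. sum (a i) S = 0"
  shows "rademacher_mean (free_norm M) n (\<lambda>i. delta_sum S (a i))
       = rademacher_mean (lip_dual_norm S) n a"
  unfolding rademacher_mean_def delta_sum_lincomb
  using free_norm_molecule[OF assms(1,2) sum_lincomb_eq_0[of "{..<n}"]] assms(3) by simp

lemma free_cotype_with_imp_molecule_cotype_with:
  "free_cotype_with M q C \<Longrightarrow> molecule_cotype_with M q C"
  unfolding free_cotype_with_def molecule_cotype_with_def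
proof (intro allI impI)
  fix n S and a :: "nat \<Rightarrow> 'a \<Rightarrow> real"
  assume *: "\<forall>n v. (\<forall>i<n. v i \<in> free_space M) \<longrightarrow>
      lq_sum (free_norm M) q n v \<le> C * rademacher_mean (free_norm M) n v"
    and "finite S \<and> S \<subseteq> M \<and> (\<forall>i<n. sum (a i) S = 0)"
  then have S: "finite S" "S \<subseteq> M" "\<forall>i<n. sum (a i) S = 0" by auto
  with * have "lq_sum (free_norm M) q n (\<lambda>i. delta_sum S (a i))
      \<le> C * rademacher_mean (free_norm M) n (\<lambda>i. delta_sum S (a i))"
    by (simp add: delta_sum_in_free_space)
  then show "lq_sum (lip_dual_norm S) q n a \<le> C * rademacher_mean (lip_dual_norm S) n a"
    unfolding lq_sum_free_norm_molecule[OF S] rademacher_mean_free_norm_molecule[OF S] .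
qed

lemma cotype_inequality_limit:
  fixes n :: nat and v :: "nat \<Rightarrow> nat \<Rightarrow> 'c \<Rightarrow> real"
  assumes "0 < q" and nonneg: "\<forall>k. \<forall>i<n. 0 \<le> N (v k i)"
    and lim: "\<forall>i<n. (\<lambda>k. N (v k i)) \<longlonglongrightarrow> N (w i)"
    and lim_signs: "\<forall>\<epsilon>. (\<lambda>k. N (\<lambda>z. \<Sum>i<n. \<epsilon> i * v k i z)) \<longlonglongrightarrow> N (\<lambda>z. \<Sum>i<n. \<epsilon> i * w i z)"
    and ineq: "\<forall>k. lq_sum N q n (v k) \<le> C * rademacher_mean N n (v k)"
  shows "lq_sum N q n w \<le> C * rademacher_mean N n w"
proof (rule LIMSEQ_le)
  have "(\<lambda>k. N (v k i) powr q) \<longlonglongrightarrow> N (w i) powr q" if "i \<in> {..<n}" for i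
    using that assms(1) nonneg lim by (intro tendsto_powr') auto
  then have "(\<lambda>k. \<Sum>i<n. N (v k i) powr q) \<longlonglongrightarrow> (\<Sum>i<n. N (w i) powr q)"
    by (rule tendsto_sum)
  then show "(\<lambda>k. lq_sum N q n (v k)) \<longlonglongrightarrow> lq_sum N q n w"
    unfolding lq_sum_def using assms(1) by (intro tendsto_powr') (auto simp: sum_nonneg)
  show "(\<lambda>k. C * rademacher_mean N n (v k)) \<longlonglongrightarrow> C * rademacher_mean N n w"
    unfolding rademacher_mean_def using lim_signs by (intro tendsto_intros) auto
qed (use ineq in auto)

lemma abs_sum_lincomb_diff_le:
  assumes "\<forall>i\<in>I. \<bar>x i - y i\<bar> \<le> (e::real)"
  shows "\<bar>(\<Sum>i\<in>I. c i * x i) - (\<Sum>i\<in>I. c i * y i)\<bar> \<le> (\<Sum>i\<in>I. \<bar>c i\<bar>) * e"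
proof -
  have "\<bar>(\<Sum>i\<in>I. c i * x i) - (\<Sum>i\<in>I. c i * y i)\<bar> = \<bar>\<Sum>i\<in>I. c i * (x i - y i)\<bar>"
    by (simp add: sum_subtractf right_diff_distrib)
  also have "\<dots> \<le> (\<Sum>i\<in>I. \<bar>c i\<bar> * \<bar>x i - y i\<bar>)"
    unfolding abs_mult[symmetric] by (rule sum_abs)
  also have "\<dots> \<le> (\<Sum>i\<in>I. \<bar>c i\<bar> * e)"
    using assms by (intro sum_mono mult_left_mono) auto
  finally show ?thesis by (simp add: sum_distrib_right)
qed

lemma molecule_cotype_with_imp_free_cotype_with:
  assumes "molecule_cotype_with M q C" "0 < q"
  shows "free_cotype_with M q C"
  unfolding free_cotype_with_def
proof (intro allI impI)
  fix n :: nat and v :: "nat \<Rightarrow> ('a \<Rightarrow> real) \<Rightarrow> real"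
  assume v: "\<forall>i<n. v i \<in> free_space M"
  obtain S a where S: "\<And>k. finite (S k)" "\<And>k. S k \<subseteq> M" "\<And>k. \<forall>i<n. sum (a k i) (S k) = 0"
    and approx: "\<And>k. \<forall>i<n. \<forall>f\<in>lip0_ball M. \<bar>v i f - delta_sum (S k) (a k i) f\<bar> \<le> 1 / real (Suc k)"
    using free_space_molecule_sequence[OF v] by blast
  define u where "u k i = delta_sum (S k) (a k i)" for k i
  have bounded: "dual_bounded M (delta_sum (S k) b)" for k b
    using dual_bounded_delta_sum[OF S(1,2)] .
  show "lq_sum (free_norm M) q n v \<le> C * rademacher_mean (free_norm M) n v"
  proof (rule cotype_inequality_limit[OF assms(2), where v = u])
    show "\<forall>k. \<forall>i<n. 0 \<le> free_norm M (u k i)"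
      unfolding u_def using bounded free_norm_nonneg by blast
    show "\<forall>i<n. (\<lambda>k. free_norm M (u k i)) \<longlonglongrightarrow> free_norm M (v i)"
      unfolding u_def using bounded approx by (intro allI impI free_norm_tendsto_uniform[where D = 1]) auto
    show "\<forall>\<epsilon>. (\<lambda>k. free_norm M (\<lambda>f. \<Sum>i<n. \<epsilon> i * u k i f))
        \<longlonglongrightarrow> free_norm M (\<lambda>f. \<Sum>i<n. \<epsilon> i * v i f)"
    proof
      fix \<epsilon> :: "nat \<Rightarrow> real"
      have bounded_signs: "dual_bounded M (\<lambda>f. \<Sum>i<n. \<epsilon> i * u k i f)" for k
        unfolding u_def delta_sum_lincomb by (rule bounded)
      have close: "\<bar>(\<Sum>i<n. \<epsilon> i * v i f) - (\<Sum>i<n. \<epsilon> i * u k i f)\<bar> \<le> (\<Sum>i<n. \<bar>\<epsilon> i\<bar>) / real (Suc k)"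
        if "f \<in> lip0_ball M" for k f
        using abs_sum_lincomb_diff_le[of "{..<n}" "\<lambda>i. v i f" "\<lambda>i. u k i f" "1 / real (Suc k)" \<epsilon>]
          approx that unfolding u_def by simp
      show "(\<lambda>k. free_norm M (\<lambda>f. \<Sum>i<n. \<epsilon> i * u k i f))
          \<longlonglongrightarrow> free_norm M (\<lambda>f. \<Sum>i<n. \<epsilon> i * v i f)"
        using bounded_signs close by (intro free_norm_tendsto_uniform) auto
    qed
    show "\<forall>k. lq_sum (free_norm M) q n (u k) \<le> C * rademacher_mean (free_norm M) n (u k)"
      using assms(1) S unfolding u_def molecule_cotype_with_def
      by (simp add: lq_sum_free_norm_molecule rademacher_mean_free_norm_molecule)
  qed
qed

lemma molecule_cotype_with_subset:
  "molecule_cotype_with M q C \<Longrightarrow> K \<subseteq> M \<Longrightarrow> molecule_cotype_with K q C"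
  unfolding molecule_cotype_with_def by blast

lemma free_cotype_with_subset:
  assumes "free_cotype_with M q C" "0 < q" "K \<subseteq> M"
  shows "free_cotype_with K q C"
  using free_cotype_with_imp_molecule_cotype_with[OF assms(1)] assms(2,3)
  by (blast intro: molecule_cotype_with_imp_free_cotype_with molecule_cotype_with_subset)

lemma free_has_cotype_subset:
  "free_has_cotype M q \<Longrightarrow> 0 < q \<Longrightarrow> K \<subseteq> M \<Longrightarrow> free_has_cotype K q"
  unfolding free_has_cotype_iff using free_cotype_with_subset by blast

lemma free_has_rademacher_cotype_subset:
  assumes "free_has_rademacher_cotype M" "K \<subseteq> M"
  shows "free_has_rademacher_cotype K"
proof -
  obtain p where p: "2 \<le> p" "free_has_cotype M p"
    using assms(1) unfolding free_has_rademacher_cotype_def by blast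
  then have "free_has_cotype K p" using free_has_cotype_subset[OF p(2) _ assms(2)] by simp
  then show ?thesis unfolding free_has_rademacher_cotype_def using p(1) by blast
qed

section \<open>Dilations and null sequences\<close>

lemma lipschitz_on_scaleR_image_iff:
  fixes S :: "'a::real_normed_vector set"
  assumes "0 < c"
  shows "L-lipschitz_on ((*\<^sub>R) c ` S) g \<longleftrightarrow> L-lipschitz_on S (\<lambda>x. g (c *\<^sub>R x) / c)"
proof -
  have "dist (g (c *\<^sub>R x)) (g (c *\<^sub>R y)) \<le> L * dist (c *\<^sub>R x) (c *\<^sub>R y)
      \<longleftrightarrow> dist (g (c *\<^sub>R x) / c) (g (c *\<^sub>R y) / c) \<le> L * dist x y" for x y
  proof -
    have "dist (c *\<^sub>R x) (c *\<^sub>R y) = c * dist x y"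
      using assms by (simp add: dist_norm flip: scaleR_diff_right)
    moreover have "dist (g (c *\<^sub>R x) / c) (g (c *\<^sub>R y) / c) = dist (g (c *\<^sub>R x)) (g (c *\<^sub>R y)) / c"
      using assms by (simp add: dist_real_def flip: diff_divide_distrib)
    ultimately show ?thesis using assms by (simp add: pos_divide_le_eq mult.commute mult.left_commute)
  qed
  then show ?thesis unfolding lipschitz_on_def by auto
qed

lemma lip_dual_norm_scaleR:
  fixes S :: "'a::real_normed_vector set"
  assumes "0 < c"
  shows "lip_dual_norm ((*\<^sub>R) c ` S) (\<lambda>y. b (y /\<^sub>R c) / c) = lip_dual_norm S b"
proof -
  have "inj_on ((*\<^sub>R) c) S" using assms by (auto intro: inj_onI)
  then have sum_eq: "(\<Sum>y\<in>(*\<^sub>R) c ` S. b (y /\<^sub>R c) / c * g y) = (\<Sum>x\<in>S. b x * (g (c *\<^sub>R x) / c))" for g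
    using assms by (simp add: sum.reindex)
  have "{\<bar>\<Sum>y\<in>(*\<^sub>R) c ` S. b (y /\<^sub>R c) / c * g y\<bar> | g. 1-lipschitz_on ((*\<^sub>R) c ` S) g}
      = {\<bar>\<Sum>x\<in>S. b x * h x\<bar> | h. 1-lipschitz_on S h}"
  proof (intro equalityI subsetI)
    fix t assume "t \<in> {\<bar>\<Sum>y\<in>(*\<^sub>R) c ` S. b (y /\<^sub>R c) / c * g y\<bar> | g. 1-lipschitz_on ((*\<^sub>R) c ` S) g}"
    then obtain g where "1-lipschitz_on ((*\<^sub>R) c ` S) g" "t = \<bar>\<Sum>y\<in>(*\<^sub>R) c ` S. b (y /\<^sub>R c) / c * g y\<bar>"
      by blast
    then show "t \<in> {\<bar>\<Sum>x\<in>S. b x * h x\<bar> | h. 1-lipschitz_on S h}"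
      unfolding sum_eq lipschitz_on_scaleR_image_iff[OF assms]
      by (intro CollectI exI[of _ "\<lambda>x. g (c *\<^sub>R x) / c"]) simp
  next
    fix t assume "t \<in> {\<bar>\<Sum>x\<in>S. b x * h x\<bar> | h. 1-lipschitz_on S h}"
    then obtain h where h: "1-lipschitz_on S h" "t = \<bar>\<Sum>x\<in>S. b x * h x\<bar>" by blast
    define g where "g y = c * h (y /\<^sub>R c)" for y
    have gh: "g (c *\<^sub>R x) / c = h x" for x unfolding g_def using assms by simp
    then show "t \<in> {\<bar>\<Sum>y\<in>(*\<^sub>R) c ` S. b (y /\<^sub>R c) / c * g y\<bar> | g. 1-lipschitz_on ((*\<^sub>R) c ` S) g}"
      unfolding sum_eq lipschitz_on_scaleR_image_iff[OF assms]
      by (intro CollectI exI[of _ g] conjI) (simp_all only: gh h)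
  qed
  then show ?thesis unfolding lip_dual_norm_def by simp
qed

lemma molecule_cotype_with_scaleR:
  fixes M :: "'a::real_normed_vector set"
  assumes "0 < c" "molecule_cotype_with ((*\<^sub>R) c ` M) q C"
  shows "molecule_cotype_with M q C"
  unfolding molecule_cotype_with_def
proof (intro allI impI)
  fix n :: nat and S :: "'a set" and a :: "nat \<Rightarrow> 'a \<Rightarrow> real"
  assume S: "finite S \<and> S \<subseteq> M \<and> (\<forall>i<n. sum (a i) S = 0)"
  define b where "b i = (\<lambda>y. a i (y /\<^sub>R c) / c)" for i
  have "inj_on ((*\<^sub>R) c) S" using assms(1) by (auto intro: inj_onI)
  then have "sum (b i) ((*\<^sub>R) c ` S) = sum (a i) S / c" for i
    unfolding b_def using assms(1) by (simp add: sum.reindex sum_divide_distrib)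
  then have "finite ((*\<^sub>R) c ` S) \<and> (*\<^sub>R) c ` S \<subseteq> (*\<^sub>R) c ` M \<and> (\<forall>i<n. sum (b i) ((*\<^sub>R) c ` S) = 0)"
    using S by auto
  then have "lq_sum (lip_dual_norm ((*\<^sub>R) c ` S)) q n b \<le> C * rademacher_mean (lip_dual_norm ((*\<^sub>R) c ` S)) n b"
    using assms(2) unfolding molecule_cotype_with_def by blast
  moreover have "lq_sum (lip_dual_norm ((*\<^sub>R) c ` S)) q n b = lq_sum (lip_dual_norm S) q n a"
    unfolding lq_sum_def b_def lip_dual_norm_scaleR[OF assms(1)] ..
  moreover have "lip_dual_norm ((*\<^sub>R) c ` S) (\<lambda>y. \<Sum>i<n. \<epsilon> i * b i y)
      = lip_dual_norm S (\<lambda>x. \<Sum>i<n. \<epsilon> i * a i x)" for \<epsilon>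
    using lip_dual_norm_scaleR[OF assms(1), of S "\<lambda>x. \<Sum>i<n. \<epsilon> i * a i x"]
    unfolding b_def by (simp add: sum_divide_distrib)
  then have "rademacher_mean (lip_dual_norm ((*\<^sub>R) c ` S)) n b = rademacher_mean (lip_dual_norm S) n a"
    unfolding rademacher_mean_def by simp
  ultimately show "lq_sum (lip_dual_norm S) q n a \<le> C * rademacher_mean (lip_dual_norm S) n a"
    by simp
qed

lemma finite_violation_in_cball:
  assumes "\<not> molecule_cotype_with (UNIV :: 'a::real_normed_vector set) q C" "0 < r"
  shows "\<exists>S :: 'a set. finite S \<and> S \<subseteq> cball 0 r \<and> \<not> molecule_cotype_with S q C"
proof -
  obtain n S and a :: "nat \<Rightarrow> 'a \<Rightarrow> real" where S: "finite S" "\<forall>i<n. sum (a i) S = 0"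
    and violation: "\<not> lq_sum (lip_dual_norm S) q n a \<le> C * rademacher_mean (lip_dual_norm S) n a"
    using assms(1) unfolding molecule_cotype_with_def by blast
  then have not_S: "\<not> molecule_cotype_with S q C"
    unfolding molecule_cotype_with_def by blast
  obtain B where B: "0 < B" "\<forall>x\<in>S. norm x \<le> B"
    using finite_imp_bounded[OF S(1)] unfolding bounded_pos by blast
  define c where "c = r / B"
  have c: "0 < c" unfolding c_def using assms(2) B(1) by simp
  have "(*\<^sub>R) c ` S \<subseteq> cball 0 r"
  proof
    fix y assume "y \<in> (*\<^sub>R) c ` S"
    then obtain x where "x \<in> S" "y = c *\<^sub>R x" by blast
    then have "norm y \<le> c * B" using B(2) c by (simp add: mult_left_mono)
    then show "y \<in> cball 0 r" unfolding c_def using B(1) by simp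
  qed
  moreover have "\<not> molecule_cotype_with ((*\<^sub>R) c ` S) q C"
    using molecule_cotype_with_scaleR[OF c] not_S by blast
  ultimately show ?thesis using S(1) by blast
qed

lemma null_sequence_with_range:
  fixes U :: "'a::real_normed_vector set"
  assumes "countable U" "0 \<in> U" and few_large: "\<And>e. 0 < e \<Longrightarrow> finite {u\<in>U. e \<le> norm u}"
  shows "\<exists>x. x \<longlonglongrightarrow> 0 \<and> range x = U"
proof -
  \<comment> \<open>an enumeration of U that takes each nonzero value only once\<close>
  define x where "x n = (if n \<in> to_nat_on U ` U then from_nat_into U n else 0)" for n
  have x_to_nat: "x (to_nat_on U u) = u" if "u \<in> U" for u
    unfolding x_def using assms(1) that by simp
  have "range x \<subseteq> U" unfolding x_def using assms(2) from_nat_into[of U] by auto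
  moreover have "U \<subseteq> range x" using x_to_nat by (metis rangeI subsetI)
  moreover have "x \<longlonglongrightarrow> 0"
    unfolding tendsto_iff
  proof (intro allI impI)
    fix e :: real assume e: "0 < e"
    have "{n. \<not> dist (x n) 0 < e} \<subseteq> to_nat_on U ` {u\<in>U. e \<le> norm u}"
    proof
      fix n assume "n \<in> {n. \<not> dist (x n) 0 < e}"
      then have large: "e \<le> norm (x n)" by simp
      then have "n \<in> to_nat_on U ` U" unfolding x_def using e by (auto split: if_splits)
      then obtain u where "u \<in> U" "n = to_nat_on U u" by blast
      then show "n \<in> to_nat_on U ` {u\<in>U. e \<le> norm u}" using large x_to_nat by auto
    qed
    then have "finite {n. \<not> dist (x n) 0 < e}"
      using few_large[OF e] finite_surj by blast
    then show "\<forall>\<^sub>F n in sequentially. dist (x n) 0 < e"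
      unfolding cofinite_eq_sequentially[symmetric] eventually_cofinite .
  qed
  ultimately show ?thesis by blast
qed

lemma null_sequence_through_shrinking_sets:
  fixes S :: "nat \<Rightarrow> 'a::real_normed_vector set"
  assumes "\<And>k. finite (S k)" "\<And>k. S k \<subseteq> cball 0 (1 / real (Suc k))"
  shows "\<exists>x. x \<longlonglongrightarrow> 0 \<and> range x = insert 0 (\<Union>k. S k)"
proof (rule null_sequence_with_range)
  show "countable (insert 0 (\<Union>k. S k))" using assms(1) by (simp add: countable_finite)
  fix e :: real assume e: "0 < e"
  obtain K :: nat where K: "1 / e < real K" using reals_Archimedean2 by blast
  have "{u \<in> insert 0 (\<Union>k. S k). e \<le> norm u} \<subseteq> (\<Union>k<K. S k)"
  proof
    fix u assume "u \<in> {u \<in> insert 0 (\<Union>k. S k). e \<le> norm u}"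
    then obtain k where u: "u \<in> S k" "e \<le> norm u" using e by auto
    then have "e \<le> 1 / real (Suc k)" using assms(2) by (fastforce simp: subset_iff)
    then have "real (Suc k) \<le> 1 / e" using e by (simp add: field_simps)
    then have "k < K" using K by simp
    then show "u \<in> (\<Union>k<K. S k)" using u(1) by blast
  qed
  then show "finite {u \<in> insert 0 (\<Union>k. S k). e \<le> norm u}"
    using assms(1) by (meson finite_UN_I finite_lessThan finite_subset)
qed simp

lemma compact_range_convergent:
  assumes "x \<longlonglongrightarrow> l" "l \<in> range x"
  shows "compact (range x)"
  using compactin_sequence_with_limit[of euclidean x l "range x"] assms
  by (simp add: insert_absorb)

lemma null_sequence_violating_molecule_cotype:
  fixes q C :: "nat \<Rightarrow> real"
  assumes "\<And>k. \<not> molecule_cotype_with (UNIV :: 'a::real_normed_vector set) (q k) (C k)"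
  shows "\<exists>x :: nat \<Rightarrow> 'a. x \<longlonglongrightarrow> 0 \<and> 0 \<in> range x \<and> (\<forall>k. \<not> molecule_cotype_with (range x) (q k) (C k))"
proof -
  have "\<forall>k. \<exists>S :: 'a set. finite S \<and> S \<subseteq> cball 0 (1 / real (Suc k)) \<and> \<not> molecule_cotype_with S (q k) (C k)"
    using finite_violation_in_cball[OF assms] by simp
  then have "\<exists>S :: nat \<Rightarrow> 'a set. \<forall>k. finite (S k) \<and> S k \<subseteq> cball 0 (1 / real (Suc k))
      \<and> \<not> molecule_cotype_with (S k) (q k) (C k)"
    by (rule choice)
  then obtain S :: "nat \<Rightarrow> 'a set" where "\<forall>k. finite (S k) \<and> S k \<subseteq> cball 0 (1 / real (Suc k))
      \<and> \<not> molecule_cotype_with (S k) (q k) (C k)"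
    by blast
  then have S: "\<And>k. finite (S k)" "\<And>k. S k \<subseteq> cball 0 (1 / real (Suc k))"
    and violation: "\<And>k. \<not> molecule_cotype_with (S k) (q k) (C k)"
    by blast+
  obtain x where x: "x \<longlonglongrightarrow> 0" "range x = insert 0 (\<Union>k. S k)"
    using null_sequence_through_shrinking_sets[OF S] by blast
  have "\<not> molecule_cotype_with (range x) (q k) (C k)" for k
    using molecule_cotype_with_subset[of "range x" "q k" "C k" "S k"] violation x(2) by blast
  then show ?thesis using x by blast
qed

lemma free_has_cotype_of_null_sequences:
  assumes "0 < q"
    and null: "\<And>x :: nat \<Rightarrow> 'a::real_normed_vector. x \<longlonglongrightarrow> 0 \<Longrightarrow> 0 \<in> range x \<Longrightarrow> free_has_cotype (range x) q"
  shows "free_has_cotype (UNIV :: 'a set) q"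
proof (rule ccontr)
  assume "\<not> ?thesis"
  then have "\<not> molecule_cotype_with (UNIV :: 'a set) q (real (Suc k))" for k
    using molecule_cotype_with_imp_free_cotype_with[OF _ assms(1)]
    unfolding free_has_cotype_iff by (metis of_nat_0_less_iff zero_less_Suc)
  then obtain x :: "nat \<Rightarrow> 'a" where x: "x \<longlonglongrightarrow> 0" "0 \<in> range x"
    and violation: "\<And>k. \<not> molecule_cotype_with (range x) q (real (Suc k))"
    using null_sequence_violating_molecule_cotype[of "\<lambda>_. q" "\<lambda>k. real (Suc k)"] by blast
  obtain C where C: "0 < C" "free_cotype_with (range x) q C"
    using null[OF x] unfolding free_has_cotype_iff by blast
  obtain k :: nat where "C \<le> real k" using real_arch_simple by blast
  then have "C \<le> real (Suc k)" by simp
  then have "free_cotype_with (range x) q (real (Suc k))"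
    using free_cotype_with_mono[OF C(2) assms(1)] by blast
  then show False using violation free_cotype_with_imp_molecule_cotype_with by blast
qed

lemma free_has_rademacher_cotype_of_null_sequences:
  assumes null: "\<And>x :: nat \<Rightarrow> 'a::real_normed_vector. x \<longlonglongrightarrow> 0 \<Longrightarrow> 0 \<in> range x
      \<Longrightarrow> free_has_rademacher_cotype (range x)"
  shows "free_has_rademacher_cotype (UNIV :: 'a set)"
proof (rule ccontr)
  assume no_cotype: "\<not> ?thesis"
  have "\<not> molecule_cotype_with (UNIV :: 'a set) (real k + 2) (real (Suc k))" for k
  proof
    assume "molecule_cotype_with (UNIV :: 'a set) (real k + 2) (real (Suc k))"
    then have "free_cotype_with (UNIV :: 'a set) (real k + 2) (real (Suc k))"
      by (rule molecule_cotype_with_imp_free_cotype_with) simp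
    then show False using no_cotype
      unfolding free_has_rademacher_cotype_def free_has_cotype_iff by force
  qed
  then obtain x :: "nat \<Rightarrow> 'a" where x: "x \<longlonglongrightarrow> 0" "0 \<in> range x"
    and violation: "\<And>k. \<not> molecule_cotype_with (range x) (real k + 2) (real (Suc k))"
    using null_sequence_violating_molecule_cotype[of "\<lambda>k. real k + 2" "\<lambda>k. real (Suc k)"] by blast
  obtain p C where p: "2 \<le> p" "0 < C" "free_cotype_with (range x) p C"
    using null[OF x] unfolding free_has_rademacher_cotype_def free_has_cotype_iff by blast
  obtain k where "max p C \<le> real k" using real_arch_simple by blast
  then have "free_cotype_with (range x) (real k + 2) (real (Suc k))"
    using p by (intro free_cotype_with_mono[OF p(3)]) auto
  then show False using violation free_cotype_with_imp_molecule_cotype_with by blast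
qed

lemma hereditary_property_iff_null_sequences:
  fixes P :: "'a::real_normed_vector set \<Rightarrow> bool"
  assumes hereditary: "\<And>K M. P M \<Longrightarrow> K \<subseteq> M \<Longrightarrow> P K"
    and null: "(\<And>x :: nat \<Rightarrow> 'a. x \<longlonglongrightarrow> 0 \<Longrightarrow> 0 \<in> range x \<Longrightarrow> P (range x)) \<Longrightarrow> P UNIV"
  shows "(P UNIV \<longleftrightarrow> (\<forall>K. compact K \<longrightarrow> P K))
       \<and> (P UNIV \<longleftrightarrow> (\<forall>K. compact K \<and> countable K \<longrightarrow> P K))
       \<and> (P UNIV \<longleftrightarrow> (\<forall>x :: nat \<Rightarrow> 'a. x \<longlonglongrightarrow> 0 \<longrightarrow> P (range x)))"
proof -
  have from_null: "P UNIV" if "\<forall>x :: nat \<Rightarrow> 'a. x \<longlonglongrightarrow> 0 \<longrightarrow> P (range x)"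
    using that by (intro null) blast
  have from_compact_countable: "P UNIV" if "\<forall>K :: 'a set. compact K \<and> countable K \<longrightarrow> P K"
    using that compact_range_convergent by (intro null) blast
  show ?thesis using hereditary[OF _ subset_UNIV] from_null from_compact_countable by blast
qed

theorem proposition5p4:
  fixes q :: real
  assumes "2 \<le> q"
  shows "(free_has_rademacher_cotype (UNIV :: 'a::banach set)
            \<longleftrightarrow> (\<forall>K::'a set. compact K \<longrightarrow> free_has_rademacher_cotype K))
       \<and> (free_has_rademacher_cotype (UNIV :: 'a set)
            \<longleftrightarrow> (\<forall>K::'a set. compact K \<and> countable K \<longrightarrow> free_has_rademacher_cotype K))
       \<and> (free_has_rademacher_cotype (UNIV :: 'a set)
            \<longleftrightarrow> (\<forall>x::nat \<Rightarrow> 'a. x \<longlonglongrightarrow> 0 \<longrightarrow> free_has_rademacher_cotype (range x)))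
       \<and> (free_has_cotype (UNIV :: 'a set) q
            \<longleftrightarrow> (\<forall>K::'a set. compact K \<longrightarrow> free_has_cotype K q))
       \<and> (free_has_cotype (UNIV :: 'a set) q
            \<longleftrightarrow> (\<forall>K::'a set. compact K \<and> countable K \<longrightarrow> free_has_cotype K q))
       \<and> (free_has_cotype (UNIV :: 'a set) q
            \<longleftrightarrow> (\<forall>x::nat \<Rightarrow> 'a. x \<longlonglongrightarrow> 0 \<longrightarrow> free_has_cotype (range x) q))"
proof -
  have q: "0 < q" using assms by linarith
  have "(free_has_rademacher_cotype (UNIV :: 'a set)
            \<longleftrightarrow> (\<forall>K::'a set. compact K \<longrightarrow> free_has_rademacher_cotype K))
       \<and> (free_has_rademacher_cotype (UNIV :: 'a set)
            \<longleftrightarrow> (\<forall>K::'a set. compact K \<and> countable K \<longrightarrow> free_has_rademacher_cotype K))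
       \<and> (free_has_rademacher_cotype (UNIV :: 'a set)
            \<longleftrightarrow> (\<forall>x::nat \<Rightarrow> 'a. x \<longlonglongrightarrow> 0 \<longrightarrow> free_has_rademacher_cotype (range x)))"
    by (rule hereditary_property_iff_null_sequences)
      (fact free_has_rademacher_cotype_subset, fact free_has_rademacher_cotype_of_null_sequences)
  moreover have "(free_has_cotype (UNIV :: 'a set) q
            \<longleftrightarrow> (\<forall>K::'a set. compact K \<longrightarrow> free_has_cotype K q))
       \<and> (free_has_cotype (UNIV :: 'a set) q
            \<longleftrightarrow> (\<forall>K::'a set. compact K \<and> countable K \<longrightarrow> free_has_cotype K q))
       \<and> (free_has_cotype (UNIV :: 'a set) q
            \<longleftrightarrow> (\<forall>x::nat \<Rightarrow> 'a. x \<longlonglongrightarrow> 0 \<longrightarrow> free_has_cotype (range x) q))"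
    by (rule hereditary_property_iff_null_sequences)
      (fact free_has_cotype_subset[OF _ q], fact free_has_cotype_of_null_sequences[OF q])
  ultimately show ?thesis by (elim conjE) (intro conjI)
qed

end
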